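(* Let $A$ be a non-empty finite set, and let $\Delta$ be a dendrogram over $A$ in general position. Then $\Delta$ can be reconstructed from its mergegram $\mathrm{MG}(\Delta)$, uniquely up to a permutation of the nodes at scale $s=0$. Precisely: if $\Delta$ and $\Delta'$ are two dendrograms over $A$, both in general position, with $\mathrm{MG}(\Delta)=\mathrm{MG}(\Delta')$ as multisets, then there is a bijection $\sigma:\Delta(0)\to\Delta'(0)$ between the initial partitions such that for every $s\ge 0$ and all $P,Q\in\Delta(0)$, the blocks $P,Q$ are contained in the same block of $\Delta(s)$ if and only if $\sigma(P),\sigma(Q)$ are contained in the same block of $\Delta'(s)$.
   Context: A partition of a set $A$ is a finite collection of non-empty pairwise disjoint subsets (blocks) of $A$ whose union is $A$. A dendrogram $\Delta$ over a set $A$ is a function assigning to each scale $s\in[0,+\infty)$ a partition $\Delta(s)$ of $A$ such that: (a) there is $r\ge 0$ such that $\Delta(s)=\{A\}$ for all $s\ge r$; (b) if $s\le t$ then $\Delta(s)$ refines $\Delta(t)$, i.e. every block of $\Delta(s)$ is a subset of some block of $\Delta(t)$; the inclusions define a map $\Delta_s^t:\Delta(s)\to\Delta(t)$; (c) there are finitely many merge scales $0=s_0<s_1<\dots<s_m$ such that $\Delta$ is constant on each interval $[s_i,s_{i+1})$, $i=0,\dots,m-1$, and on $[s_m,+\infty)$, and $\Delta(s_i)\ne\Delta(s_{i+1})$ for $i=0,\dots,m-1$. Merge sets: every block of $\Delta(0)$ is a merge set with birth scale $0$; for $i\ge 0$, a block $B\in\Delta(s_{i+1})$ whose preimage under $\Delta_{s_i}^{s_{i+1}}$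 consists of at least two blocks of $\Delta(s_i)$ is a merge set with birth scale $s_{i+1}$. If a merge set $B$ has birth scale $b$, its death scale is $d=\sup\{s\ge b : \Delta_b^s(B)=B\}\in(b,+\infty]$, and $\mathrm{life}(B)=[b,d)$. The mergegram $\mathrm{MG}(\Delta)$ is the multiset containing one pair $(\mathrm{birth},\mathrm{death})$ for each merge set $B$ of $\Delta$ with $\mathrm{life}(B)=[\mathrm{birth},\mathrm{death})$ (repeated pairs counted with multiplicity; death may be $+\infty$). General position means that all mergers occur at different scales: at each merge scale $s_{i+1}>0$ exactly two blocks of $\Delta(s_i)$ merge into one block of $\Delta(s_{i+1})$ and all other blocks are unchanged. *)

theory Defs
  imports Complex_Main "HOL-Library.Disjoint_Sets" "HOL-Library.Multiset"
    "HOL-Library.Extended_Real"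
begin

text \<open>
  A family of partitions indexed by scales in \<open>[0, \<infinity>)\<close> is encoded as a function
  \<open>\<Delta> :: real \<Rightarrow> 'a set set\<close>; every definition below only inspects its values at
  non-negative scales, so the values at negative scales are irrelevant.
\<close>

definition merge_scales :: "(real \<Rightarrow> 'a set set) \<Rightarrow> real list \<Rightarrow> bool" where
  "merge_scales \<Delta> ss \<longleftrightarrow>
     ss \<noteq> [] \<and> hd ss = 0 \<and> sorted_wrt (<) ss \<and>
     (\<forall>i. Suc i < length ss \<longrightarrow> (\<forall>s\<in>{ss ! i..<ss ! Suc i}. \<Delta> s = \<Delta> (ss ! i))) \<and>
     (\<forall>s\<ge>last ss. \<Delta> s = \<Delta> (last ss)) \<and>
     (\<forall>i. Suc i < length ss \<longrightarrow> \<Delta> (ss ! i) \<noteq> \<Delta> (ss ! Suc i))"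

definition dendrogram :: "'a set \<Rightarrow> (real \<Rightarrow> 'a set set) \<Rightarrow> bool" where
  "dendrogram A \<Delta> \<longleftrightarrow>
     (\<forall>s\<ge>0. partition_on A (\<Delta> s) \<and> finite (\<Delta> s)) \<and>
     (\<exists>r\<ge>0. \<forall>s\<ge>r. \<Delta> s = {A}) \<and>
     (\<forall>s t. 0 \<le> s \<and> s \<le> t \<longrightarrow> refines A (\<Delta> s) (\<Delta> t)) \<and>
     (\<exists>ss. merge_scales \<Delta> ss)"

text \<open>
  The map \<open>\<Delta>\<^sub>s\<^sup>t : \<Delta>(s) \<rightarrow> \<Delta>(t)\<close> induced by the inclusions of blocks. The block
  containing \<open>C\<close> is unique because \<open>C\<close> is non-empty and the blocks of \<open>\<Delta>(t)\<close> are disjoint.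
\<close>

definition block_map :: "(real \<Rightarrow> 'a set set) \<Rightarrow> real \<Rightarrow> real \<Rightarrow> 'a set \<Rightarrow> 'a set" where
  "block_map \<Delta> s t C = (THE D. D \<in> \<Delta> t \<and> C \<subseteq> D)"

text \<open>
  The list of merge scales of a dendrogram is unique, so the choice of \<open>ss\<close> in the next
  definitions is immaterial.
\<close>

definition has_birth :: "(real \<Rightarrow> 'a set set) \<Rightarrow> 'a set \<Rightarrow> real \<Rightarrow> bool" where
  "has_birth \<Delta> B b \<longleftrightarrow>
     (b = 0 \<and> B \<in> \<Delta> 0) \<or>
     (\<exists>ss i. merge_scales \<Delta> ss \<and> Suc i < length ss \<and> b = ss ! Suc i \<and>
        B \<in> \<Delta> (ss ! Suc i) \<and>
        2 \<le> card {C \<in> \<Delta> (ss ! i). block_map \<Delta> (ss ! i) (ss ! Suc i) C = B})"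

definition merge_sets :: "(real \<Rightarrow> 'a set set) \<Rightarrow> 'a set set" where
  "merge_sets \<Delta> = {B. \<exists>b. has_birth \<Delta> B b}"

text \<open>
  A merge set has only one birth scale: a block present at some scale cannot arise at a
  later scale as a union of two or more blocks.
\<close>

definition birth :: "(real \<Rightarrow> 'a set set) \<Rightarrow> 'a set \<Rightarrow> real" where
  "birth \<Delta> B = (THE b. has_birth \<Delta> B b)"

definition death :: "(real \<Rightarrow> 'a set set) \<Rightarrow> 'a set \<Rightarrow> ereal" where
  "death \<Delta> B = Sup {ereal s | s. birth \<Delta> B \<le> s \<and> block_map \<Delta> (birth \<Delta> B) s B = B}"

text \<open>
  For a dendrogram over a finite set, \<open>merge_sets \<Delta>\<close> is finite (its members are subsets of
  that set), so \<open>mset_set\<close> counts every merge set exactly once.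
\<close>

definition mergegram :: "(real \<Rightarrow> 'a set set) \<Rightarrow> (real \<times> ereal) multiset" where
  "mergegram \<Delta> = image_mset (\<lambda>B. (birth \<Delta> B, death \<Delta> B)) (mset_set (merge_sets \<Delta>))"

definition general_position :: "(real \<Rightarrow> 'a set set) \<Rightarrow> bool" where
  "general_position \<Delta> \<longleftrightarrow>
     (\<exists>ss. merge_scales \<Delta> ss \<and>
        (\<forall>i. Suc i < length ss \<longrightarrow>
           (\<exists>P Q. P \<in> \<Delta> (ss ! i) \<and> Q \<in> \<Delta> (ss ! i) \<and> P \<noteq> Q \<and>
              \<Delta> (ss ! Suc i) = insert (P \<union> Q) (\<Delta> (ss ! i) - {P, Q}))))"

end

theory Submission
  imports Defs
begin

text \<open>
  Equality of the mergegrams yields a bijection \<open>\<phi>\<close> between the merge sets that preserves births and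
  deaths. The blocks at scale \<open>s\<close> are the merge sets alive at \<open>s\<close>, so \<open>\<phi>\<close> maps \<open>\<Delta>(s)\<close> onto \<open>\<Delta>'(s)\<close>.
  In general position a merge set born at \<open>b > 0\<close> is the union of the only two merge sets that die
  at \<open>b\<close>; hence \<open>\<phi>\<close> respects these unions, and by induction on the size of a merge set it respects the
  inclusion of initial blocks. Therefore \<open>\<sigma>\<close> can be taken to be the restriction of \<open>\<phi>\<close> to \<open>\<Delta>(0)\<close>.
\<close>

section \<open>Bijections from equal image multisets\<close>

text \<open>Induction on \<open>S\<close>: some \<open>y\<close> in \<open>T\<close> has the value
  \<open>f x\<close>, and removing \<open>x\<close> and \<open>y\<close> leaves equal multisets. It
  turns equality of mergegrams into a matching of merge sets.\<close>

lemma image_mset_mset_set_eqE: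
  assumes "finite S" "finite T"
    and "image_mset f (mset_set S) = image_mset g (mset_set T)"
  obtains \<phi> where "bij_betw \<phi> S T" "\<And>x. x \<in> S \<Longrightarrow> g (\<phi> x) = f x"
proof -
  have "\<exists>\<phi>. bij_betw \<phi> S T \<and> (\<forall>x\<in>S. g (\<phi> x) = f x)"
    using assms
  proof (induction S arbitrary: T rule: finite_induct)
    case empty
    then show ?case by (simp add: mset_set_empty_iff bij_betw_def)
  next
    case (insert x S)
    have "f x \<in># image_mset f (mset_set (insert x S))"
      using insert.hyps by simp
    then have "f x \<in> g ` T"
      using insert.prems by simp
    then obtain y where y: "y \<in> T" "g y = f x" by auto
    have "mset_set T = add_mset y (mset_set (T - {y}))"
      using insert.prems(1) y(1) by (simp add: mset_set.remove)
    then have "image_mset f (mset_set S) = image_mset g (mset_set (T - {y}))"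
      using insert.prems(2) insert.hyps y(2) by simp
    then obtain \<phi> where \<phi>: "bij_betw \<phi> S (T - {y})" "\<forall>x\<in>S. g (\<phi> x) = f x"
      using insert.IH[of "T - {y}"] insert.prems(1) by blast
    have "bij_betw (\<phi>(x := y)) S (T - {y})"
      using \<phi>(1) insert.hyps(2) by (subst bij_betw_cong[where g = \<phi>]) auto
    then have "bij_betw (\<phi>(x := y)) (insert x S) T"
      using notIn_Un_bij_betw[of x S "\<phi>(x := y)" "T - {y}"] insert.hyps(2) y(1)
      by (simp add: insert_absorb)
    moreover have "\<forall>z\<in>insert x S. g ((\<phi>(x := y)) z) = f z"
      using \<phi>(2) y(2) by simp
    ultimately show ?case by blast
  qed
  then show ?thesis using that by blast
qed

section \<open>Blocks at different scales\<close>

locale dendro =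
  fixes A :: "'a set" and \<Delta> :: "real \<Rightarrow> 'a set set"
  assumes dendrogram: "dendrogram A \<Delta>"
begin

lemma partition: "0 \<le> s \<Longrightarrow> partition_on A (\<Delta> s)"
  using dendrogram by (simp add: dendrogram_def)

lemma block_eqI: "\<lbrakk>0 \<le> s; B \<in> \<Delta> s; C \<in> \<Delta> s; B \<inter> C \<noteq> {}\<rbrakk> \<Longrightarrow> B = C"
  using partition[of s] by (meson disjointD partition_on_def)

lemma block_nonempty: "0 \<le> s \<Longrightarrow> B \<in> \<Delta> s \<Longrightarrow> B \<noteq> {}"
  using partition[of s] by (auto simp: partition_on_def)

lemma block_subset_eq: "\<lbrakk>0 \<le> s; B \<in> \<Delta> s; C \<in> \<Delta> s; B \<subseteq> C\<rbrakk> \<Longrightarrow> B = C"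
  using block_eqI block_nonempty by (metis inf.absorb1)

lemma refinesE:
  assumes "0 \<le> s" "s \<le> t" "B \<in> \<Delta> s"
  obtains C where "C \<in> \<Delta> t" "B \<subseteq> C"
proof -
  have "refines A (\<Delta> s) (\<Delta> t)" using dendrogram assms(1,2) by (simp add: dendrogram_def)
  then show ?thesis using that assms(3) by (auto simp: refines_def)
qed

lemma block_subset_or_disjoint:
  assumes "0 \<le> s" "s \<le> t" "B \<in> \<Delta> s" "C \<in> \<Delta> t"
  shows "B \<subseteq> C \<or> B \<inter> C = {}"
proof -
  obtain D where "D \<in> \<Delta> t" "B \<subseteq> D" using refinesE assms by metis
  moreover have "D = C" if "B \<inter> C \<noteq> {}"
    using block_eqI[of t D C] that calculation assms by auto
  ultimately show ?thesis by auto
qed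

text \<open>Any block of \<open>\<Delta> u\<close> containing \<open>B\<close> lies in a block of
  \<open>\<Delta> t\<close>, which must be \<open>B\<close> itself. Hence a block that has vanished
  never returns.\<close>

lemma block_convex:
  assumes "0 \<le> s" "s \<le> u" "u \<le> t" "B \<in> \<Delta> s" "B \<in> \<Delta> t"
  shows "B \<in> \<Delta> u"
proof -
  obtain D where D: "D \<in> \<Delta> u" "B \<subseteq> D" using refinesE assms by metis
  obtain E where E: "E \<in> \<Delta> t" "D \<subseteq> E" using refinesE[of u t D] assms D by auto
  have "B = E"
    using block_subset_eq[of t B E] assms D E by auto
  then show ?thesis using D E by auto
qed

text \<open>Existence comes from refinement, uniqueness from the disjointness of the blocks at
  \<open>t\<close> together with \<open>C\<close> being non-empty.\<close>

lemma block_map_eq_iff: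
  assumes "0 \<le> s" "s \<le> t" "C \<in> \<Delta> s"
  shows "block_map \<Delta> s t C = D \<longleftrightarrow> D \<in> \<Delta> t \<and> C \<subseteq> D"
proof -
  have uniq: "D = D'" if "D \<in> \<Delta> t \<and> C \<subseteq> D" "D' \<in> \<Delta> t \<and> C \<subseteq> D'" for D D'
  proof (rule block_eqI[of t])
    show "D \<inter> D' \<noteq> {}" using that block_nonempty[OF assms(1,3)] by blast
  qed (use that assms in auto)
  obtain E where E: "E \<in> \<Delta> t \<and> C \<subseteq> E" using refinesE[OF assms] by blast
  then have "block_map \<Delta> s t C = E"
    unfolding block_map_def by (rule the_equality) (rule uniq[OF _ E])
  then show ?thesis using uniq[of E D] E by blast
qed

section \<open>Merge scales and intervals of constancy\<close>

lemma merge_scalesE: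
  obtains ss where "merge_scales \<Delta> ss"
  using dendrogram unfolding dendrogram_def by blast

lemma merge_scales_less_iff:
  assumes "merge_scales \<Delta> ss" "i < length ss" "j < length ss"
  shows "ss ! i < ss ! j \<longleftrightarrow> i < j"
proof -
  have "sorted_wrt (<) ss" using assms by (simp add: merge_scales_def)
  then show ?thesis
    using assms(2,3) sorted_wrt_nth_less by (metis linorder_less_linear order_less_asym)
qed

lemma merge_scales_0: "merge_scales \<Delta> ss \<Longrightarrow> ss ! 0 = 0"
  unfolding merge_scales_def by (metis hd_conv_nth)

lemma merge_scales_nonneg:
  assumes "merge_scales \<Delta> ss" "i < length ss"
  shows "0 \<le> ss ! i"
  using merge_scales_less_iff[of ss i 0] merge_scales_0[of ss] assms
  by (metis gr_implies_not0 le_less_trans not_le le0)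

lemma merge_scales_const:
  assumes "merge_scales \<Delta> ss" "Suc i < length ss" "ss ! i \<le> u" "u < ss ! Suc i"
  shows "\<Delta> u = \<Delta> (ss ! i)"
  using assms unfolding merge_scales_def by (meson atLeastLessThan_iff)

text \<open>The index is the largest one with \<open>ss ! i \<le> s\<close>. The end
  \<open>t\<close> lies strictly beyond \<open>s\<close>, so the family is constant just to the
  right of every scale.\<close>

lemma merge_scales_cell:
  assumes ss: "merge_scales \<Delta> ss" and "0 \<le> s"
  obtains i t where "i < length ss" "ss ! i \<le> s" "s < t" "\<forall>u\<in>{ss ! i..<t}. \<Delta> u = \<Delta> (ss ! i)"
proof -
  define I where "I = {i. i < length ss \<and> ss ! i \<le> s}"
  have fin: "finite I" by (simp add: I_def)
  have "0 \<in> I"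
    using ss merge_scales_0[OF ss] \<open>0 \<le> s\<close> by (simp add: I_def merge_scales_def)
  then have "Max I \<in> I" using Max_in fin by blast
  then have max: "Max I < length ss" "ss ! Max I \<le> s" by (auto simp: I_def)
  show ?thesis
  proof (cases "Suc (Max I) < length ss")
    case True
    have less: "s < ss ! Suc (Max I)"
    proof (rule ccontr)
      assume "\<not> s < ss ! Suc (Max I)"
      then have "Suc (Max I) \<in> I" using True by (simp add: I_def)
      then show False using Max_ge[OF fin] Suc_n_not_le_n by blast
    qed
    have "\<forall>u\<in>{ss ! Max I..<ss ! Suc (Max I)}. \<Delta> u = \<Delta> (ss ! Max I)"
      using merge_scales_const[OF ss True] by (meson atLeastLessThan_iff)
    from that[OF max less this] show ?thesis .
  next
    case False
    then have "Max I = length ss - 1" using max by simp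
    moreover have "ss \<noteq> []" using ss by (simp add: merge_scales_def)
    ultimately have "ss ! Max I = last ss" by (simp add: last_conv_nth)
    then have "\<forall>u\<ge>ss ! Max I. \<Delta> u = \<Delta> (ss ! Max I)"
      using ss unfolding merge_scales_def by metis
    then have "\<forall>u\<in>{ss ! Max I..<s + 1}. \<Delta> u = \<Delta> (ss ! Max I)"
      by (meson atLeastLessThan_iff)
    from that[OF max _ this] show ?thesis by simp
  qed
qed

text \<open>Constancy to the right of \<open>s\<close>. This makes the comparison with the death
  scale strict in \<open>block_iff_alive\<close>.\<close>

lemma block_persists:
  assumes "0 \<le> s" "B \<in> \<Delta> s"
  obtains t where "s < t" "B \<in> \<Delta> t"
proof -
  obtain ss where ss: "merge_scales \<Delta> ss" by (rule merge_scalesE)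
  obtain i t where i: "i < length ss" "ss ! i \<le> s" "s < t" "\<forall>u\<in>{ss ! i..<t}. \<Delta> u = \<Delta> (ss ! i)"
    by (rule merge_scales_cell[OF ss assms(1)])
  obtain t' where "s < t'" "t' < t" using dense[OF i(3)] by blast
  then have "\<Delta> t' = \<Delta> s" using bspec[OF i(4), of t'] bspec[OF i(4), of s] i(2,3) by simp
  then show ?thesis using that \<open>s < t'\<close> assms by simp
qed

section \<open>First appearance of a block and birth scales\<close>

text \<open>The infimum of the scales carrying \<open>B\<close> is attained: if \<open>B\<close> is
  a block at \<open>u\<close>, it is already one at some merge scale \<open>\<le> u\<close>, so the
  merge scale of least index will do.\<close>

lemma first_scaleE:
  assumes "0 \<le> s" "B \<in> \<Delta> s"
  obtains b where "0 \<le> b" "B \<in> \<Delta> b" "\<And>u. \<lbrakk>0 \<le> u; u < b\<rbrakk> \<Longrightarrow> B \<notin> \<Delta> u"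
proof -
  obtain ss where ss: "merge_scales \<Delta> ss" by (rule merge_scalesE)
  define Q where "Q i \<longleftrightarrow> i < length ss \<and> B \<in> \<Delta> (ss ! i)" for i
  have Q: "\<exists>i. Q i \<and> ss ! i \<le> u" if "0 \<le> u" "B \<in> \<Delta> u" for u
  proof -
    obtain i t where i: "i < length ss" "ss ! i \<le> u" "u < t"
      "\<forall>v\<in>{ss ! i..<t}. \<Delta> v = \<Delta> (ss ! i)"
      by (rule merge_scales_cell[OF ss \<open>0 \<le> u\<close>])
    have "\<Delta> u = \<Delta> (ss ! i)" by (rule bspec[OF i(4)]) (use i(2,3) in simp)
    then show ?thesis using that(2) i(1,2) by (auto simp: Q_def)
  qed
  define i where "i = (LEAST i. Q i)"
  have i: "Q i" unfolding i_def using Q[OF assms] by (blast intro: LeastI)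
  have min: "i \<le> k" if "Q k" for k
    unfolding i_def using that by (rule Least_le)
  show ?thesis
  proof (rule that[of "ss ! i"])
    show "0 \<le> ss ! i" "B \<in> \<Delta> (ss ! i)"
      using i merge_scales_nonneg[OF ss] by (auto simp: Q_def)
    fix u assume u: "0 \<le> u" "u < ss ! i"
    show "B \<notin> \<Delta> u"
    proof
      assume "B \<in> \<Delta> u"
      then obtain k where "Q k" "ss ! k \<le> u" using Q u by blast
      then have "Q k" "ss ! k < ss ! i" using u by auto
      then show False
        using min[of k] merge_scales_less_iff[OF ss, of k i] i by (simp add: Q_def)
    qed
  qed
qed

text \<open>The left end of the constancy interval around \<open>b\<close> already carries
  \<open>B\<close>, so by \<open>new\<close> it cannot precede \<open>b\<close>. Positivity of
  \<open>b\<close> excludes index 0.\<close>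

lemma first_scale_is_merge_scale:
  assumes ss: "merge_scales \<Delta> ss" and "0 < b" "B \<in> \<Delta> b"
    and new: "\<And>u. \<lbrakk>0 \<le> u; u < b\<rbrakk> \<Longrightarrow> B \<notin> \<Delta> u"
  obtains j where "Suc j < length ss" "b = ss ! Suc j"
proof -
  obtain i t where i: "i < length ss" "ss ! i \<le> b" "b < t"
    "\<forall>u\<in>{ss ! i..<t}. \<Delta> u = \<Delta> (ss ! i)"
    by (rule merge_scales_cell[OF ss less_imp_le[OF \<open>0 < b\<close>]])
  have "\<Delta> b = \<Delta> (ss ! i)" by (rule bspec[OF i(4)]) (use i(2,3) in simp)
  then have "B \<in> \<Delta> (ss ! i)" using \<open>B \<in> \<Delta> b\<close> by simp
  then have "b = ss ! i"
    using new[of "ss ! i"] i(2) merge_scales_nonneg[OF ss i(1)] by fastforce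
  moreover from this have "i \<noteq> 0" using merge_scales_0[OF ss] \<open>0 < b\<close> by (intro notI) simp
  then obtain j where "i = Suc j" by (cases i) auto
  ultimately show ?thesis using that[of j] i(1) by blast
qed

text \<open>Removes the list of merge scales and the counting of preimages. A block present earlier
  would be its own only preimage; conversely the preimages of a block cover it, so a single one
  would equal it and the block would not be new.\<close>

lemma has_birth_iff:
  "has_birth \<Delta> B b \<longleftrightarrow> 0 \<le> b \<and> B \<in> \<Delta> b \<and> (\<forall>u. 0 \<le> u \<and> u < b \<longrightarrow> B \<notin> \<Delta> u)"
    (is "_ \<longleftrightarrow> ?R")
proof
  assume "has_birth \<Delta> B b"
  then consider "b = 0" "B \<in> \<Delta> 0" |
    ss i where "merge_scales \<Delta> ss" "Suc i < length ss" "b = ss ! Suc i" "B \<in> \<Delta> b"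
        "2 \<le> card {C \<in> \<Delta> (ss ! i). block_map \<Delta> (ss ! i) b C = B}"
    unfolding has_birth_def by blast
  then show ?R
  proof cases
    case 1
    then show ?thesis by auto
  next
    case 2
    have nn: "0 \<le> ss ! i" "ss ! i < b"
      using 2 merge_scales_nonneg[of ss i] merge_scales_less_iff[of ss i "Suc i"] by auto
    have False if u: "0 \<le> u" "u < b" "B \<in> \<Delta> u" for u
    proof -
      \<comment> \<open>Convexity moves the occurrence of \<open>B\<close> into the interval from
        \<open>ss ! i\<close> to \<open>b\<close>, where the partition is still that of
        \<open>ss ! i\<close>.\<close>
      have "B \<in> \<Delta> (max u (ss ! i))"
        using block_convex[of u _ b] u nn 2 by auto
      moreover have "\<Delta> (max u (ss ! i)) = \<Delta> (ss ! i)"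
        by (rule merge_scales_const[OF 2(1,2)]) (use u(2) nn(2) 2(3) in auto)
      ultimately have Bi: "B \<in> \<Delta> (ss ! i)" by simp
      have "C = B" if C: "C \<in> \<Delta> (ss ! i)" and "block_map \<Delta> (ss ! i) b C = B" for C
      proof (rule block_subset_eq[OF nn(1) C Bi])
        show "C \<subseteq> B" using block_map_eq_iff[of "ss ! i" b C B] that nn by simp
      qed
      then have "{C \<in> \<Delta> (ss ! i). block_map \<Delta> (ss ! i) b C = B} \<subseteq> {B}" by blast
      then have "card {C \<in> \<Delta> (ss ! i). block_map \<Delta> (ss ! i) b C = B} \<le> 1"
        by (rule order.trans[OF card_mono[rotated]]) auto
      then show False using 2(5) by simp
    qed
    then show ?thesis using 2(4) nn by auto
  qed
next
  assume R: ?R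
  show "has_birth \<Delta> B b"
  proof (cases "b = 0")
    case True
    then show ?thesis using R by (simp add: has_birth_def)
  next
    case False
    then have "0 < b" using R by simp
    obtain ss where ss: "merge_scales \<Delta> ss" by (rule merge_scalesE)
    obtain i where i: "Suc i < length ss" "b = ss ! Suc i"
      using first_scale_is_merge_scale[OF ss \<open>0 < b\<close>] R by blast
    have nn: "0 \<le> ss ! i" "ss ! i < b"
      using i merge_scales_nonneg[OF ss, of i] merge_scales_less_iff[OF ss, of i "Suc i"] by auto
    define S where "S = {C \<in> \<Delta> (ss ! i). block_map \<Delta> (ss ! i) b C = B}"
    have S: "S = {C \<in> \<Delta> (ss ! i). C \<subseteq> B}"
      unfolding S_def using block_map_eq_iff[OF nn(1) less_imp_le[OF nn(2)]] R
      by (intro Collect_cong) blast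
    have "B \<subseteq> \<Union>S"
    proof
      fix x assume x: "x \<in> B"
      then have "x \<in> A" using partition[of b] R by (auto simp: partition_on_def)
      then obtain C where C: "C \<in> \<Delta> (ss ! i)" "x \<in> C"
        using partition[OF nn(1)] by (auto simp: partition_on_def)
      then have "C \<subseteq> B"
        using block_subset_or_disjoint[of "ss ! i" b C B] nn R x by auto
      then show "x \<in> \<Union>S" using C by (auto simp: S)
    qed
    then have US: "\<Union>S = B" by (auto simp: S)
    have "finite (\<Delta> (ss ! i))" using dendrogram nn by (simp add: dendrogram_def)
    then have "finite S" by (simp add: S_def)
    have "\<not> card S \<le> 1"
    proof
      assume "card S \<le> 1"
      then have eq: "\<forall>C\<in>S. \<forall>D\<in>S. C = D"
        using card_le_Suc0_iff_eq[OF \<open>finite S\<close>] by simp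
      obtain C where "C \<in> S" using US block_nonempty[of b B] R by blast
      then have "S = {C}" using eq by blast
      then have "B \<in> \<Delta> (ss ! i)" using US S by auto
      then show False using R nn by blast
    qed
    then have "2 \<le> card S" by simp
    then show ?thesis
      unfolding has_birth_def S_def using ss i R by (intro disjI2 exI[of _ ss] exI[of _ i]) simp
  qed
qed

lemma merge_sets_iff: "B \<in> merge_sets \<Delta> \<longleftrightarrow> (\<exists>s\<ge>0. B \<in> \<Delta> s)"
proof
  assume "\<exists>s\<ge>0. B \<in> \<Delta> s"
  then obtain s where "0 \<le> s" "B \<in> \<Delta> s" by blast
  then obtain b where "has_birth \<Delta> B b" by (rule first_scaleE) (use has_birth_iff in blast)
  then show "B \<in> merge_sets \<Delta>" unfolding merge_sets_def by blast
qed (auto simp: merge_sets_def has_birth_iff)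

lemma finite_merge_sets:
  assumes "finite A" shows "finite (merge_sets \<Delta>)"
proof (rule finite_subset)
  show "merge_sets \<Delta> \<subseteq> Pow A"
  proof
    fix B assume "B \<in> merge_sets \<Delta>"
    then obtain s where "0 \<le> s" "B \<in> \<Delta> s" by (auto simp: merge_sets_iff)
    then show "B \<in> Pow A" using partition_onD1[OF partition] by blast
  qed
qed (use assms in simp)

lemma has_birth_birth:
  assumes "B \<in> merge_sets \<Delta>"
  shows "has_birth \<Delta> B (birth \<Delta> B)"
proof -
  obtain b where b: "has_birth \<Delta> B b" using assms by (auto simp: merge_sets_def)
  moreover have "b' = b" if "has_birth \<Delta> B b'" for b'
    using that b unfolding has_birth_iff by (cases b b' rule: linorder_cases) auto
  ultimately show ?thesis unfolding birth_def by (rule theI)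
qed

lemma birth_nonneg: "B \<in> merge_sets \<Delta> \<Longrightarrow> 0 \<le> birth \<Delta> B"
  and block_at_birth: "B \<in> merge_sets \<Delta> \<Longrightarrow> B \<in> \<Delta> (birth \<Delta> B)"
  using has_birth_birth by (auto simp: has_birth_iff)

lemma birth_le: "0 \<le> s \<Longrightarrow> B \<in> \<Delta> s \<Longrightarrow> birth \<Delta> B \<le> s"
  using has_birth_birth[of B] by (force simp: has_birth_iff merge_sets_iff)

section \<open>Lifetimes and death scales\<close>

text \<open>The condition on \<open>block_map\<close> only says that \<open>B\<close> is still a
  block at \<open>s\<close>; the lower bound by the birth scale is then automatic.\<close>

lemma death_eq_Sup:
  assumes "B \<in> merge_sets \<Delta>"
  shows "death \<Delta> B = Sup (ereal ` {s. 0 \<le> s \<and> B \<in> \<Delta> s})"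
proof -
  have "birth \<Delta> B \<le> s \<and> block_map \<Delta> (birth \<Delta> B) s B = B \<longleftrightarrow> 0 \<le> s \<and> B \<in> \<Delta> s" for s
    using block_map_eq_iff[of "birth \<Delta> B" s B B] birth_le[of s B]
      birth_nonneg[OF assms] block_at_birth[OF assms] by auto
  then show ?thesis unfolding death_def by (simp add: image_Collect)
qed

text \<open>Recovers \<open>\<Delta> s\<close> from the lifetimes of the merge sets. A block
  persists a little past \<open>s\<close>, hence the strict inequality; conversely a supremum beyond
  \<open>s\<close> gives a later occurrence, and convexity fills the gap back to the birth.\<close>

lemma block_iff_alive:
  assumes "B \<in> merge_sets \<Delta>" "0 \<le> s"
  shows "B \<in> \<Delta> s \<longleftrightarrow> birth \<Delta> B \<le> s \<and> ereal s < death \<Delta> B"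
proof (intro iffI conjI)
  assume B: "B \<in> \<Delta> s"
  then show "birth \<Delta> B \<le> s" using birth_le assms by simp
  obtain t where t: "s < t" "B \<in> \<Delta> t" using block_persists[OF assms(2) B] by blast
  then show "ereal s < death \<Delta> B"
    unfolding death_eq_Sup[OF assms(1)] less_Sup_iff
    using assms(2) by (intro bexI[of _ "ereal t"] imageI) auto
next
  assume R: "birth \<Delta> B \<le> s \<and> ereal s < death \<Delta> B"
  then obtain t where "s < t" "B \<in> \<Delta> t"
    unfolding death_eq_Sup[OF assms(1)] less_Sup_iff by auto
  then show "B \<in> \<Delta> s"
    using block_convex[of "birth \<Delta> B" s t B] R assms birth_nonneg block_at_birth by simp
qed

lemma birth_less_death: "B \<in> merge_sets \<Delta> \<Longrightarrow> ereal (birth \<Delta> B) < death \<Delta> B"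
  using block_iff_alive birth_nonneg block_at_birth by blast

text \<open>Nothing can vanish strictly inside an interval of constancy. The lemma identifies the
  blocks consumed at \<open>b\<close> by their death scale alone.\<close>

lemma death_eq_iff:
  assumes C: "C \<in> merge_sets \<Delta>" and "0 \<le> a" "a < b"
    and const: "\<And>u. \<lbrakk>a \<le> u; u < b\<rbrakk> \<Longrightarrow> \<Delta> u = \<Delta> a"
  shows "death \<Delta> C = ereal b \<longleftrightarrow> C \<in> \<Delta> a \<and> C \<notin> \<Delta> b"
proof
  assume d: "death \<Delta> C = ereal b"
  \<comment> \<open>The maximum covers both a birth before \<open>a\<close> and one inside the
    interval.\<close>
  let ?m = "max (birth \<Delta> C) a"
  have "?m < b" using birth_less_death[OF C] d \<open>a < b\<close> by simp
  then have "C \<in> \<Delta> ?m" using block_iff_alive[OF C, of ?m] d \<open>0 \<le> a\<close> by simp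
  then have "C \<in> \<Delta> a" using const[of ?m] \<open>?m < b\<close> by simp
  moreover have "C \<notin> \<Delta> b" using block_iff_alive[OF C, of b] d assms(2,3) by simp
  ultimately show "C \<in> \<Delta> a \<and> C \<notin> \<Delta> b" ..
next
  assume R: "C \<in> \<Delta> a \<and> C \<notin> \<Delta> b"
  have a: "birth \<Delta> C \<le> a" "ereal a < death \<Delta> C"
    using block_iff_alive[OF C, of a] R assms(2,3) by auto
  show "death \<Delta> C = ereal b"
  proof (rule antisym)
    show "death \<Delta> C \<le> ereal b"
      using block_iff_alive[OF C, of b] R a assms(2,3) by auto
    show "ereal b \<le> death \<Delta> C"
    proof (rule ccontr)
      assume "\<not> ereal b \<le> death \<Delta> C"
      \<comment> \<open>An earlier death would fall at a real scale strictly between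
        \<open>a\<close> and \<open>b\<close>, where constancy keeps \<open>C\<close> alive.\<close>
      then obtain r where r: "death \<Delta> C = ereal r" "a < r" "r < b"
        using a by (cases "death \<Delta> C") auto
      then have "C \<in> \<Delta> r" using const[of r] R by simp
      then show False using block_iff_alive[OF C, of r] r assms(2,3) by simp
    qed
  qed
qed

section \<open>Mergers in general position\<close>

text \<open>Being new at its birth scale, \<open>B\<close> is the one block created there, and in
  general position exactly its two parts disappear. The last clause singles out the parts by their
  death scale, which the mergegram records.\<close>

lemma merge_set_split:
  assumes gp: "general_position \<Delta>" and B: "B \<in> merge_sets \<Delta>" and pos: "0 < birth \<Delta> B"
  obtains P Q where "P \<noteq> Q" "P \<subset> B" "Q \<subset> B" "B = P \<union> Q"
    "{C \<in> merge_sets \<Delta>. death \<Delta> C = ereal (birth \<Delta> B)} = {P, Q}"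
proof -
  let ?b = "birth \<Delta> B"
  obtain ss where ss: "merge_scales \<Delta> ss"
    and merger: "\<And>i. Suc i < length ss \<Longrightarrow> \<exists>P Q. P \<in> \<Delta> (ss ! i) \<and> Q \<in> \<Delta> (ss ! i) \<and> P \<noteq> Q \<and>
              \<Delta> (ss ! Suc i) = insert (P \<union> Q) (\<Delta> (ss ! i) - {P, Q})"
    using gp unfolding general_position_def by blast
  have new: "\<And>u. \<lbrakk>0 \<le> u; u < ?b\<rbrakk> \<Longrightarrow> B \<notin> \<Delta> u"
    using has_birth_birth[OF B] by (auto simp: has_birth_iff)
  obtain i where i: "Suc i < length ss" "?b = ss ! Suc i"
    using first_scale_is_merge_scale[OF ss pos block_at_birth[OF B] new] by blast
  let ?a = "ss ! i"
  have nn: "0 \<le> ?a" "?a < ?b"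
    using i merge_scales_nonneg[OF ss, of i] merge_scales_less_iff[OF ss, of i "Suc i"] by auto
  obtain P Q where PQ: "P \<in> \<Delta> ?a" "Q \<in> \<Delta> ?a" "P \<noteq> Q"
    and b: "\<Delta> ?b = insert (P \<union> Q) (\<Delta> ?a - {P, Q})"
    using merger[OF i(1)] i(2) by auto
  have BPQ: "B = P \<union> Q" using block_at_birth[OF B] new[OF nn] b by auto
  \<comment> \<open>Distinct blocks of one partition are incomparable, so both parts are proper and
    neither is a block at \<open>?b\<close>.\<close>
  have proper: "\<not> P \<subseteq> Q" "\<not> Q \<subseteq> P"
    using block_subset_eq[OF nn(1)] PQ by auto
  have "death \<Delta> C = ereal ?b \<longleftrightarrow> C = P \<or> C = Q" if "C \<in> merge_sets \<Delta>" for C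
  proof -
    have "death \<Delta> C = ereal ?b \<longleftrightarrow> C \<in> \<Delta> ?a \<and> C \<notin> \<Delta> ?b"
      by (rule death_eq_iff[OF that nn]) (use merge_scales_const[OF ss i(1)] i(2) in metis)
    also have "\<dots> \<longleftrightarrow> C = P \<or> C = Q"
      using b PQ proper new[OF nn] BPQ by blast
    finally show ?thesis .
  qed
  moreover have "P \<in> merge_sets \<Delta>" "Q \<in> merge_sets \<Delta>"
    using PQ nn(1) by (auto simp: merge_sets_iff)
  ultimately have "{C \<in> merge_sets \<Delta>. death \<Delta> C = ereal ?b} = {P, Q}" by blast
  moreover have "P \<subset> B" "Q \<subset> B" using BPQ proper by auto
  ultimately show ?thesis using that PQ(3) BPQ by blast
qed

lemma initial_merge_set_iff:
  "B \<in> merge_sets \<Delta> \<and> birth \<Delta> B = 0 \<longleftrightarrow> B \<in> \<Delta> 0"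
  using block_at_birth birth_le birth_nonneg merge_sets_iff
  by (metis order.antisym order.refl)

text \<open>A merge set either contains the initial block \<open>P\<close> or is disjoint from it,
  so \<open>P\<close> cannot be split between \<open>C\<close> and \<open>D\<close>.\<close>

lemma initial_subset_iff:
  assumes "P \<in> \<Delta> 0" "C \<in> merge_sets \<Delta>" "D \<in> merge_sets \<Delta>"
  shows "P \<subseteq> C \<union> D \<longleftrightarrow> P \<subseteq> C \<or> P \<subseteq> D"
  using assms block_subset_or_disjoint[of 0 _ P] unfolding merge_sets_iff by blast

end

section \<open>Bijections preserving births and deaths\<close>

text \<open>Induction on the size of \<open>B\<close>. Between initial blocks inclusion is equality;
  any other merge set is the union of two smaller ones, and \<open>\<phi>\<close> carries them to
  the two parts of \<open>\<phi> B\<close>.\<close>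

lemma birth_death_bij_subset_iff:
  assumes "finite A" "dendrogram A \<Delta>" "general_position \<Delta>" "dendrogram A' \<Delta>'" "general_position \<Delta>'"
    and bij: "bij_betw \<phi> (merge_sets \<Delta>) (merge_sets \<Delta>')"
    and pres: "\<And>B. B \<in> merge_sets \<Delta> \<Longrightarrow> birth \<Delta>' (\<phi> B) = birth \<Delta> B \<and> death \<Delta>' (\<phi> B) = death \<Delta> B"
    and P: "P \<in> \<Delta> 0" and B: "B \<in> merge_sets \<Delta>"
  shows "P \<subseteq> B \<longleftrightarrow> \<phi> P \<subseteq> \<phi> B"
proof -
  interpret D: dendro A \<Delta> using assms by unfold_locales
  interpret D': dendro A' \<Delta>' using assms by unfold_locales
  have im: "\<phi> C \<in> merge_sets \<Delta>'" if "C \<in> merge_sets \<Delta>" for C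
    using bij that by (rule bij_betwE[THEN bspec])
  have inj: "\<phi> C = \<phi> E \<longleftrightarrow> C = E" if "C \<in> merge_sets \<Delta>" "E \<in> merge_sets \<Delta>" for C E
    using bij that by (metis bij_betw_def inj_on_eq_iff)
  have init: "\<phi> C \<in> \<Delta>' 0" if "C \<in> \<Delta> 0" for C
    using that im pres by (metis D.initial_merge_set_iff D'.initial_merge_set_iff)
  have Pm: "P \<in> merge_sets \<Delta>" using P by (auto simp: D.merge_sets_iff)
  have "finite B" if "B \<in> merge_sets \<Delta>" for B
    using that \<open>finite A\<close> D.partition
    by (metis D.merge_sets_iff Sup_upper finite_subset partition_onD1)
  then show ?thesis
    using B
  proof (induction "card B" arbitrary: B rule: less_induct)
    case less
    note B = less.prems(2)
    show ?case
    proof (cases "birth \<Delta> B = 0")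
      case True
      then have B0: "B \<in> \<Delta> 0" using B D.initial_merge_set_iff by blast
      have "P \<subseteq> B \<longleftrightarrow> P = B"
        using D.block_subset_eq[of 0 P B] B0 P by auto
      also have "\<dots> \<longleftrightarrow> \<phi> P = \<phi> B" using inj Pm B by simp
      also have "\<dots> \<longleftrightarrow> \<phi> P \<subseteq> \<phi> B"
        using D'.block_subset_eq[of 0 "\<phi> P" "\<phi> B"] init P B0 by auto
      finally show ?thesis .
    next
      case False
      then have pos: "0 < birth \<Delta> B" using D.birth_nonneg[OF B] by simp
      obtain C E where CE: "C \<noteq> E" "C \<subset> B" "E \<subset> B" "B = C \<union> E"
        and d: "{X \<in> merge_sets \<Delta>. death \<Delta> X = ereal (birth \<Delta> B)} = {C, E}"
        by (rule D.merge_set_split[OF assms(3) B pos])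
      have CEm: "C \<in> merge_sets \<Delta>" "E \<in> merge_sets \<Delta>"
        and CEd: "death \<Delta> C = ereal (birth \<Delta> B)" "death \<Delta> E = ereal (birth \<Delta> B)"
        using d by auto
      have pos': "0 < birth \<Delta>' (\<phi> B)" using pos pres[OF B] by simp
      obtain C' E' where C'E': "\<phi> B = C' \<union> E'"
        and d': "{X \<in> merge_sets \<Delta>'. death \<Delta>' X = ereal (birth \<Delta>' (\<phi> B))} = {C', E'}"
        by (rule D'.merge_set_split[OF assms(5) im[OF B] pos'])
      \<comment> \<open>The images of both parts die exactly when \<open>\<phi> B\<close> is
        born.\<close>
      have "\<phi> C \<in> {C', E'}" "\<phi> E \<in> {C', E'}"
        unfolding d'[symmetric] using im pres B CEm CEd by auto
      moreover have "\<phi> C \<noteq> \<phi> E" using inj CEm CE(1) by simp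
      \<comment> \<open>Two distinct members exhaust \<open>{C', E'}\<close>; injectivity of
        \<open>\<phi>\<close> is what yields the whole union.\<close>
      ultimately have \<phi>B: "\<phi> B = \<phi> C \<union> \<phi> E" using C'E' by blast
      have "card C < card B" "card E < card B"
        using CE(2,3) less.prems by (simp_all add: psubset_card_mono)
      then have "P \<subseteq> C \<longleftrightarrow> \<phi> P \<subseteq> \<phi> C" "P \<subseteq> E \<longleftrightarrow> \<phi> P \<subseteq> \<phi> E"
        using less.hyps less.prems(1) CEm by blast+
      then show ?thesis
        using D.initial_subset_iff[OF P CEm] D'.initial_subset_iff[OF init[OF P] im im, OF CEm]
        by (simp add: CE(4) \<phi>B[unfolded CE(4)])
    qed
  qed
qed

section \<open>Reconstruction from the mergegram\<close>

theorem theorem4p6: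
  fixes A :: "'a set" and \<Delta> \<Delta>' :: "real \<Rightarrow> 'a set set"
  assumes "finite A" and "A \<noteq> {}"
    and "dendrogram A \<Delta>" and "general_position \<Delta>"
    and "dendrogram A \<Delta>'" and "general_position \<Delta>'"
    and "mergegram \<Delta> = mergegram \<Delta>'"
  shows "\<exists>\<sigma>. bij_betw \<sigma> (\<Delta> 0) (\<Delta>' 0) \<and>
    (\<forall>s\<ge>0. \<forall>P\<in>\<Delta> 0. \<forall>Q\<in>\<Delta> 0.
       (\<exists>B\<in>\<Delta> s. P \<subseteq> B \<and> Q \<subseteq> B) \<longleftrightarrow> (\<exists>B\<in>\<Delta>' s. \<sigma> P \<subseteq> B \<and> \<sigma> Q \<subseteq> B))"
proof -
  interpret D: dendro A \<Delta> using assms by unfold_locales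
  interpret D': dendro A \<Delta>' using assms by unfold_locales
  obtain \<phi> where bij: "bij_betw \<phi> (merge_sets \<Delta>) (merge_sets \<Delta>')"
    and pres: "\<And>B. B \<in> merge_sets \<Delta> \<Longrightarrow> birth \<Delta>' (\<phi> B) = birth \<Delta> B \<and> death \<Delta>' (\<phi> B) = death \<Delta> B"
    using image_mset_mset_set_eqE[OF D.finite_merge_sets D'.finite_merge_sets] assms(1,7)
    unfolding mergegram_def by (smt (verit, best) prod.inject)
  have subset_iff: "P \<subseteq> B \<longleftrightarrow> \<phi> P \<subseteq> \<phi> B" if "P \<in> \<Delta> 0" "B \<in> merge_sets \<Delta>" for P B
    by (rule birth_death_bij_subset_iff[OF assms(1,3-6) bij pres that])
  have im: "\<phi> ` merge_sets \<Delta> = merge_sets \<Delta>'" using bij by (rule bij_betw_imp_surj_on)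
  \<comment> \<open>Being alive at \<open>s\<close> depends only on birth and death, which
    \<open>\<phi>\<close> preserves.\<close>
  have blocks: "\<phi> ` \<Delta> s = \<Delta>' s" if "0 \<le> s" for s
  proof -
    have "\<Delta> s = {B \<in> merge_sets \<Delta>. birth \<Delta> B \<le> s \<and> ereal s < death \<Delta> B}"
      using D.block_iff_alive[OF _ that] D.merge_sets_iff that by blast
    moreover have "\<Delta>' s = {B \<in> merge_sets \<Delta>'. birth \<Delta>' B \<le> s \<and> ereal s < death \<Delta>' B}"
      using D'.block_iff_alive[OF _ that] D'.merge_sets_iff that by blast
    ultimately show ?thesis using pres unfolding im[symmetric] by auto
  qed
  have sub: "\<Delta> s \<subseteq> merge_sets \<Delta>" if "0 \<le> s" for s
    using that by (auto simp: D.merge_sets_iff)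
  have "bij_betw \<phi> (\<Delta> 0) (\<Delta>' 0)"
    using bij_betw_subset[OF bij sub] blocks by simp
  moreover have "(\<exists>B\<in>\<Delta> s. P \<subseteq> B \<and> Q \<subseteq> B) \<longleftrightarrow> (\<exists>B\<in>\<Delta>' s. \<phi> P \<subseteq> B \<and> \<phi> Q \<subseteq> B)"
    if "0 \<le> s" "P \<in> \<Delta> 0" "Q \<in> \<Delta> 0" for s P Q
  proof -
    have "P \<subseteq> B \<and> Q \<subseteq> B \<longleftrightarrow> \<phi> P \<subseteq> \<phi> B \<and> \<phi> Q \<subseteq> \<phi> B" if "B \<in> \<Delta> s" for B
      using subset_iff[OF _ subsetD[OF sub[OF \<open>0 \<le> s\<close>] that]] \<open>P \<in> \<Delta> 0\<close> \<open>Q \<in> \<Delta> 0\<close> by simp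
    \<comment> \<open>Every block of \<open>\<Delta>' s\<close> is the image of a block of
      \<open>\<Delta> s\<close>, so the existence of a common block transfers in both
      directions.\<close>
    then show ?thesis unfolding blocks[OF \<open>0 \<le> s\<close>, symmetric] by simp
  qed
  ultimately show ?thesis by blast
qed

end
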